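(* Let $A_1,\dots,A_n\in\mathbb{R}^d$, $A=[A_1,\dots,A_n]\in\mathbb{R}^{d\times n}$ and $\lambda>0$. Suppose $g:\mathbb{R}^d\to\mathbb{R}$ is $1$-strongly convex and each convex function $\phi_i:\mathbb{R}\to\mathbb{R}$, $i=1,\dots,n$, is $1/\gamma$-smooth and also $1/\eta$-strongly convex ($\gamma,\eta>0$), all with respect to the Euclidean norm. Given any dual point $x^{(k)}\in\mathbb{R}^n$, let $w^{(k)}=\nabla g^*\big(\frac{1}{\lambda n}Ax^{(k)}\big)$. Then $$P(w^{(k)})-D(x^{(k)})\ \le\ \frac{\lambda\eta n+\|A\|_2^2}{\lambda\gamma n}\,\big(D^\star-D(x^{(k)})\big),$$ where $\|A\|_2$ is the spectral norm of $A$ and $D^\star=\max_{x\in\mathbb{R}^n}D(x)$.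
   Context: $\phi$ is $1/\gamma$-smooth if it is differentiable with $(1/\gamma)$-Lipschitz derivative. $\phi_i^*(u)=\sup_z\{zu-\phi_i(z)\}$ and $g^*$ denote convex conjugates ($g^*$ is differentiable since $g$ is $1$-strongly convex). The primal and dual objectives of regularized empirical risk minimization are $$P(w)=\frac1n\sum_{i=1}^n\phi_i(A_i^Tw)+\lambda g(w)\ (w\in\mathbb{R}^d),\qquad D(x)=\frac1n\sum_{i=1}^n-\phi_i^*(-x_i)-\lambda g^*\Big(\frac{1}{\lambda n}Ax\Big)\ (x\in\mathbb{R}^n).$$ *)

theory Defs
  imports "HOL-Analysis.Analysis"
begin

definition strongly_convex :: "real \<Rightarrow> ('a::real_inner \<Rightarrow> real) \<Rightarrow> bool" where
  "strongly_convex m f \<longleftrightarrow>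
     (\<forall>x y. \<forall>t\<in>{0..1}. f (t *\<^sub>R x + (1 - t) *\<^sub>R y)
        \<le> t * f x + (1 - t) * f y - m / 2 * t * (1 - t) * (norm (x - y))\<^sup>2)"

definition smooth_with :: "real \<Rightarrow> (real \<Rightarrow> real) \<Rightarrow> bool" where
  "smooth_with L f \<longleftrightarrow> f differentiable_on UNIV \<and> L-lipschitz_on UNIV (deriv f)"

(* The supremum is taken in the reals.  It is a genuine (finite) supremum for strongly convex
   real-valued functions on a Euclidean space, the only functions it is applied to here.
   On type real the inner product is multiplication. *)
definition convex_conjugate :: "('a::real_inner \<Rightarrow> real) \<Rightarrow> 'a \<Rightarrow> real" where
  "convex_conjugate f u = (SUP z. u \<bullet> z - f z)"

(* Meaningful where f is differentiable; GDERIV determines its vector uniquely. *)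
definition gradient :: "('a::real_inner \<Rightarrow> real) \<Rightarrow> 'a \<Rightarrow> 'a" where
  "gradient f x = (THE v. GDERIV f x :> v)"

(* The operator norm induced by the Euclidean norms. *)
definition spectral_norm :: "real^'n^'d \<Rightarrow> real" where
  "spectral_norm A = onorm (\<lambda>x. A *v x)"

definition primal_obj ::
  "real^'n^'d \<Rightarrow> real \<Rightarrow> (real^'d \<Rightarrow> real) \<Rightarrow> ('n::finite \<Rightarrow> real \<Rightarrow> real) \<Rightarrow> real^'d \<Rightarrow> real" where
  "primal_obj A lam g \<phi> w =
     1 / real CARD('n) * (\<Sum>i\<in>UNIV. \<phi> i (column i A \<bullet> w)) + lam * g w"

definition dual_obj ::
  "real^'n^'d \<Rightarrow> real \<Rightarrow> (real^'d \<Rightarrow> real) \<Rightarrow> ('n::finite \<Rightarrow> real \<Rightarrow> real) \<Rightarrow> real^'n \<Rightarrow> real" where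
  "dual_obj A lam g \<phi> x =
     1 / real CARD('n) * (\<Sum>i\<in>UNIV. - convex_conjugate (\<phi> i) (- (x $ i)))
     - lam * convex_conjugate g ((1 / (lam * real CARD('n))) *\<^sub>R (A *v x))"

definition dual_opt ::
  "real^'n^'d \<Rightarrow> real \<Rightarrow> (real^'d \<Rightarrow> real) \<Rightarrow> ('n::finite \<Rightarrow> real \<Rightarrow> real) \<Rightarrow> real" where
  "dual_opt A lam g \<phi> = (SUP x. dual_obj A lam g \<phi> x)"

end

theory Submission
  imports Defs
begin

text \<open>Let \<open>z\<^sub>i\<close> maximise \<open>- x\<^sub>i z - \<phi>\<^sub>i z\<close> and put \<open>d\<^sub>i = z\<^sub>i - A\<^sub>i\<^sup>T w\<close>, so that \<open>d\<close> is \<open>n\<close> times the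
  gradient of the dual objective. By the Fenchel equality for \<open>g\<close> and smoothness of
  \<open>\<phi>\<^sub>i\<close>, the duality gap is at most \<open>\<parallel>d\<parallel>\<^sup>2 / (2 \<gamma> n)\<close>. Strong convexity of \<open>\<phi>\<^sub>i\<close> and \<open>g\<close> bounds
  their conjugates from above by quadratics, so that \<open>D\<close> is \<open>L\<close>-smooth with
  \<open>L = (\<lambda> \<eta> n + \<parallel>A\<parallel>\<^sup>2) / (\<lambda> n\<^sup>2)\<close> and one gradient step increases \<open>D\<close> by at least
  \<open>\<parallel>d\<parallel>\<^sup>2 / (2 n\<^sup>2 L)\<close>. The maximum of \<open>D\<close> exists because smoothness of \<open>\<phi>\<^sub>i\<close> makes \<open>- D\<close>
  strongly convex.\<close>

section \<open>Strong convexity: minimisers and quadratic growth\<close>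

lemma strongly_convex_imp_convex_on:
  assumes "strongly_convex m f" and "m \<ge> 0"
  shows "convex_on UNIV f"
proof (rule convex_onI)
  fix t :: real and x y :: 'a
  assume t: "0 < t" "t < 1"
  have "f ((1 - t) *\<^sub>R x + (1 - (1 - t)) *\<^sub>R y)
      \<le> (1 - t) * f x + (1 - (1 - t)) * f y - m / 2 * (1 - t) * (1 - (1 - t)) * (norm (x - y))\<^sup>2"
    using assms(1)[unfolded strongly_convex_def, rule_format, of "1 - t" x y] t by simp
  moreover have "m / 2 * (1 - t) * (1 - (1 - t)) * (norm (x - y))\<^sup>2 \<ge> 0"
    using t assms(2) by simp
  ultimately show "f ((1 - t) *\<^sub>R x + t *\<^sub>R y) \<le> (1 - t) * f x + t * f y"
    by simp
qed auto

lemma strongly_convex_diff_inner: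
  assumes "strongly_convex m f"
  shows "strongly_convex m (\<lambda>z. f z - v \<bullet> z)"
  unfolding strongly_convex_def
proof (intro allI ballI)
  fix x y :: 'a and t :: real
  assume "t \<in> {0..1}"
  then have "f (t *\<^sub>R x + (1 - t) *\<^sub>R y)
        \<le> t * f x + (1 - t) * f y - m / 2 * t * (1 - t) * (norm (x - y))\<^sup>2"
    using assms unfolding strongly_convex_def by blast
  then show "f (t *\<^sub>R x + (1 - t) *\<^sub>R y) - v \<bullet> (t *\<^sub>R x + (1 - t) *\<^sub>R y)
        \<le> t * (f x - v \<bullet> x) + (1 - t) * (f y - v \<bullet> y) - m / 2 * t * (1 - t) * (norm (x - y))\<^sup>2"
    by (simp add: inner_add_right inner_diff_right algebra_simps)
qed

text \<open>A minimiser over a large enough ball is global: far from the origin, strong convexity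
  along the segment from \<open>0\<close> to \<open>y\<close> pushes \<open>f y\<close> up to at
  least \<open>f 0\<close>.\<close>

lemma strongly_convex_attains_min:
  fixes f :: "'a::euclidean_space \<Rightarrow> real"
  assumes sc: "strongly_convex m f" and m: "m > 0"
  shows "\<exists>w. \<forall>y. f w \<le> f y"
proof -
  have cont: "continuous_on UNIV f"
    using convex_on_continuous[OF open_UNIV strongly_convex_imp_convex_on[OF sc]] m by simp
  have "\<exists>w\<in>cball 0 1. \<forall>y\<in>cball 0 1. f w \<le> f y"
    by (intro continuous_attains_inf continuous_on_subset[OF cont]) auto
  then obtain u where u: "\<And>y. norm y \<le> 1 \<Longrightarrow> f u \<le> f y"
    by (metis mem_cball_0)
  \<comment> \<open>The segment from \<open>0\<close> to a far \<open>y\<close> crosses the unit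
    sphere, where \<open>f\<close> is at least \<open>f u\<close>. The strong convexity term at that
    crossing is \<open>m / 2 * (norm y - 1)\<close>, and \<open>R\<close> is the radius at which it
    equals the drop \<open>f 0 - f u\<close>.\<close>
  define R where "R = 1 + 2 * (f 0 - f u) / m"
  have u0: "f u \<le> f 0" using u[of 0] by simp
  have R: "R \<ge> 1" using u0 m by (simp add: R_def)
  have far: "f 0 \<le> f y" if y: "norm y > R" for y
  proof -
    let ?r = "norm y"
    have r: "?r > 1" using y R by simp
    have "f ((1 / ?r) *\<^sub>R y + (1 - 1 / ?r) *\<^sub>R 0)
        \<le> 1 / ?r * f y + (1 - 1 / ?r) * f 0 - m / 2 * (1 / ?r) * (1 - 1 / ?r) * (norm (y - 0))\<^sup>2"
      using sc[unfolded strongly_convex_def, rule_format, of "1 / ?r" y 0] r by (simp add: divide_le_eq_1)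
    moreover have "f u \<le> f ((1 / ?r) *\<^sub>R y + (1 - 1 / ?r) *\<^sub>R 0)"
      using r by (intro u) simp
    moreover have "m / 2 * (1 / ?r) * (1 - 1 / ?r) * (norm (y - 0))\<^sup>2 = m / 2 * (?r - 1)"
      using r by (auto simp: field_simps power2_eq_square)
    moreover have "m / 2 * (?r - 1) \<ge> m / 2 * (R - 1)"
      using y m by simp
    moreover have "m / 2 * (R - 1) = f 0 - f u"
      using m by (simp add: R_def)
    moreover have "1 / ?r * f y + (1 - 1 / ?r) * f 0 = f 0 + (f y - f 0) / ?r"
      by (simp add: field_simps diff_divide_distrib)
    ultimately have "0 \<le> (f y - f 0) / ?r" by linarith
    then show ?thesis using r by (auto simp: zero_le_divide_iff)
  qed
  have "\<exists>w\<in>cball 0 R. \<forall>y\<in>cball 0 R. f w \<le> f y"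
    using R by (intro continuous_attains_inf continuous_on_subset[OF cont]) auto
  then obtain w where w: "\<And>y. norm y \<le> R \<Longrightarrow> f w \<le> f y"
    by (metis mem_cball_0)
  have "f w \<le> f y" for y
    using w[of y] far[of y] w[of 0] R by force
  then show ?thesis by blast
qed

text \<open>Strong convexity between \<open>w\<close> and \<open>y\<close>, divided by the weight
  \<open>t\<close> of \<open>y\<close>, gives the bound with an extra factor \<open>1 - t\<close>;
  as \<open>t\<close> tends to 0 the factor disappears.\<close>

lemma strongly_convex_growth:
  assumes sc: "strongly_convex m f" and min: "\<And>y. f w \<le> f y"
  shows "f w + m / 2 * (norm (y - w))\<^sup>2 \<le> f y"
proof -
  have "m / 2 * (norm (y - w))\<^sup>2 \<le> f y - f w"
  proof (rule field_le_mult_one_interval)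
    fix s :: real
    assume s: "0 < s" "s < 1"
    define t where "t = 1 - s"
    have t: "0 < t" "t < 1" using s by (auto simp: t_def)
    have "f (t *\<^sub>R y + (1 - t) *\<^sub>R w) \<le> t * f y + (1 - t) * f w - m / 2 * t * (1 - t) * (norm (y - w))\<^sup>2"
      using sc t unfolding strongly_convex_def by auto
    then have "t * ((1 - t) * (m / 2 * (norm (y - w))\<^sup>2)) \<le> t * (f y - f w)"
      using min[of "t *\<^sub>R y + (1 - t) *\<^sub>R w"] by (simp add: algebra_simps)
    then show "s * (m / 2 * (norm (y - w))\<^sup>2) \<le> f y - f w"
      using t by (simp add: t_def)
  qed
  then show ?thesis by simp
qed

section \<open>Conjugates of strongly convex functions\<close>

lemma convex_conjugate_eqI:
  assumes "\<And>y. v \<bullet> y - f y \<le> v \<bullet> w - f w"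
  shows "convex_conjugate f v = v \<bullet> w - f w"
  unfolding convex_conjugate_def
  by (rule cSup_eq_maximum) (use assms in auto)

lemma convex_conjugate_attained:
  fixes f :: "'a::euclidean_space \<Rightarrow> real"
  assumes "strongly_convex m f" "m > 0"
  obtains w where "\<And>y. v \<bullet> y - f y \<le> v \<bullet> w - f w"
    "convex_conjugate f v = v \<bullet> w - f w"
proof -
  obtain w where "f w - v \<bullet> w \<le> f y - v \<bullet> y" for y
    using strongly_convex_attains_min[OF strongly_convex_diff_inner[OF assms(1)] assms(2), of v] by blast
  then have *: "v \<bullet> y - f y \<le> v \<bullet> w - f w" for y
    by (metis minus_diff_eq neg_le_iff_le)
  then show ?thesis
    using that convex_conjugate_eqI by blast
qed

lemma convex_conjugate_ge:
  fixes f :: "'a::euclidean_space \<Rightarrow> real"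
  assumes "strongly_convex m f" "m > 0"
  shows "v \<bullet> y - f y \<le> convex_conjugate f v"
  using convex_conjugate_attained[OF assms, of v] by metis

text \<open>This is the \<open>1 / m\<close>-smoothness of the conjugate. Quadratic growth of
  \<open>f x - v \<bullet> x\<close> away from \<open>w\<close>, taken at the maximiser
  \<open>y\<close> for \<open>v + e\<close>, leaves only
  \<open>e \<bullet> (y - w) - m / 2 * (norm (y - w))\<^sup>2\<close> to bound.\<close>

lemma convex_conjugate_upper:
  fixes f :: "'a::euclidean_space \<Rightarrow> real"
  assumes sc: "strongly_convex m f" and m: "m > 0"
    and w: "\<And>y. v \<bullet> y - f y \<le> v \<bullet> w - f w"
  shows "convex_conjugate f (v + e) \<le> convex_conjugate f v + e \<bullet> w + (norm e)\<^sup>2 / (2 * m)"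
proof -
  obtain y where y: "convex_conjugate f (v + e) = (v + e) \<bullet> y - f y"
    using convex_conjugate_attained[OF sc m] by metis
  have "f w - v \<bullet> w \<le> f x - v \<bullet> x" for x using w[of x] by linarith
  then have g: "f w - v \<bullet> w + m / 2 * (norm (y - w))\<^sup>2 \<le> f y - v \<bullet> y"
    by (rule strongly_convex_growth[OF strongly_convex_diff_inner[OF sc]])
  \<comment> \<open>Young's inequality for \<open>e \<bullet> (y - w)\<close>, obtained by expanding
    a square.\<close>
  have "0 \<le> (norm (e - m *\<^sub>R (y - w)))\<^sup>2 / (2 * m)"
    using m by simp
  also have "(norm (e - m *\<^sub>R (y - w)))\<^sup>2
      = (norm e)\<^sup>2 - 2 * m * (e \<bullet> (y - w)) + m\<^sup>2 * (norm (y - w))\<^sup>2"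
    unfolding power2_norm_eq_inner
    by (simp add: inner_diff_left inner_diff_right inner_commute algebra_simps power2_eq_square)
  also have "\<dots> / (2 * m) = (norm e)\<^sup>2 / (2 * m) - e \<bullet> (y - w) + m / 2 * (norm (y - w))\<^sup>2"
    using m by (simp add: field_simps power2_eq_square)
  finally show ?thesis
    using g y convex_conjugate_eqI[OF w] by (simp add: inner_add_left inner_diff_right)
qed

text \<open>Testing the supremum at \<open>v + e\<close> with the old maximiser \<open>w\<close>
  shows that \<open>w\<close> is a subgradient of the conjugate at \<open>v\<close>.\<close>

lemma convex_conjugate_lower:
  fixes f :: "'a::euclidean_space \<Rightarrow> real"
  assumes "strongly_convex m f" "m > 0"
    and w: "\<And>y. v \<bullet> y - f y \<le> v \<bullet> w - f w"
  shows "convex_conjugate f v + e \<bullet> w \<le> convex_conjugate f (v + e)"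
  using convex_conjugate_ge[OF assms(1,2), of "v + e" w] convex_conjugate_eqI[OF w]
  by (simp add: inner_add_left)

text \<open>The two preceding bounds place the first-order remainder between 0 and
  \<open>(norm e)\<^sup>2 / (2 * m)\<close>.\<close>

lemma GDERIV_convex_conjugate:
  fixes f :: "'a::euclidean_space \<Rightarrow> real"
  assumes sc: "strongly_convex m f" and m: "m > 0"
    and w: "\<And>y. v \<bullet> y - f y \<le> v \<bullet> w - f w"
  shows "GDERIV (convex_conjugate f) v :> w"
  unfolding gderiv_def
proof (rule has_derivativeI_sandwich[of 1])
  show "((\<lambda>y. norm (y - v) / (2 * m)) \<longlongrightarrow> 0) (at v)"
    using m by (auto intro!: tendsto_eq_intros)
next
  fix y assume "y \<in> UNIV" "y \<noteq> v" "dist y v < 1"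
  have "norm (convex_conjugate f y - convex_conjugate f v - (y - v) \<bullet> w) \<le> (norm (y - v))\<^sup>2 / (2 * m)"
    using convex_conjugate_upper[OF sc m w, of "y - v"] convex_conjugate_lower[OF sc m w, of "y - v"]
    by simp
  also have "\<dots> = norm (y - v) / (2 * m) * norm (y - v)"
    by (simp add: power2_eq_square)
  finally show "norm (convex_conjugate f y - convex_conjugate f v - (y - v) \<bullet> w) / norm (y - v)
      \<le> norm (y - v) / (2 * m)"
    using \<open>y \<noteq> v\<close> by (simp add: pos_divide_le_eq)
qed (auto intro: bounded_linear_inner_left)

lemma gradient_eqI:
  assumes "GDERIV f x :> v"
  shows "gradient f x = v"
  unfolding gradient_def
proof (rule the_equality)
  show "GDERIV f x :> v" by (rule assms)
next
  fix u assume "GDERIV f x :> u"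
  then have "(\<lambda>h. h \<bullet> u) = (\<lambda>h. h \<bullet> v)"
    using assms has_derivative_unique unfolding gderiv_def by blast
  then have "(u - v) \<bullet> u = (u - v) \<bullet> v" by metis
  then have "(u - v) \<bullet> (u - v) = 0" by (simp add: inner_diff_right)
  then show "u = v" by simp
qed

section \<open>From smoothness to strong convexity of the conjugate\<close>

lemma smooth_with_upper:
  assumes "smooth_with L f"
  shows "f y \<le> f z + deriv f z * (y - z) + L / 2 * (y - z)\<^sup>2"
proof -
  \<comment> \<open>The slack in the claimed bound. It vanishes at \<open>z\<close>, and the
    Lipschitz condition gives its derivative the sign of \<open>x - z\<close>, so it is smallest at
    \<open>z\<close>.\<close>
  define \<psi> where "\<psi> y = f z + deriv f z * (y - z) + L / 2 * (y - z)\<^sup>2 - f y" for y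
  have df: "(f has_real_derivative deriv f x) (at x)" for x
    using assms unfolding smooth_with_def differentiable_on_def
    by (metis DERIV_deriv_iff_real_differentiable UNIV_I)
  have d\<psi>: "(\<psi> has_real_derivative deriv f z + L * (x - z) - deriv f x) (at x)" for x
    unfolding \<psi>_def by (auto intro!: derivative_eq_intros df)
  have lip: "\<bar>deriv f x - deriv f z\<bar> \<le> L * \<bar>x - z\<bar>" for x
    using assms lipschitz_onD[of L UNIV "deriv f" x z] unfolding smooth_with_def dist_real_def by auto
  have "0 \<le> \<psi> y"
  proof (cases "z \<le> y")
    case True
    have "\<psi> z \<le> \<psi> y"
    proof (rule DERIV_nonneg_imp_nondecreasing[OF True])
      fix x assume "z \<le> x" "x \<le> y"
      then show "\<exists>D. (\<psi> has_real_derivative D) (at x) \<and> 0 \<le> D"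
        using d\<psi>[of x] lip[of x] by (intro exI[of _ "deriv f z + L * (x - z) - deriv f x"]) auto
    qed
    then show ?thesis by (simp add: \<psi>_def)
  next
    case False
    then have yz: "y \<le> z" by simp
    have "\<psi> z \<le> \<psi> y"
    proof (rule DERIV_nonpos_imp_nonincreasing[OF yz])
      fix x assume "y \<le> x" "x \<le> z"
      then show "\<exists>D. (\<psi> has_real_derivative D) (at x) \<and> D \<le> 0"
        using d\<psi>[of x] lip[of x]
        by (intro exI[of _ "deriv f z + L * (x - z) - deriv f x"]) (auto simp: abs_if algebra_simps split: if_splits)
    qed
    then show ?thesis by (simp add: \<psi>_def)
  qed
  then show ?thesis by (simp add: \<psi>_def)
qed

text \<open>The maximiser \<open>z\<close> is a stationary point, so the slope \<open>u\<close> can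
  replace \<open>deriv f z\<close>.\<close>

lemma smooth_with_upper_argmax:
  assumes sm: "smooth_with L f" and z: "\<And>y. u * y - f y \<le> u * z - f z"
  shows "f y \<le> f z + u * (y - z) + L / 2 * (y - z)\<^sup>2"
proof -
  have "(f has_real_derivative deriv f z) (at z)"
    using sm unfolding smooth_with_def differentiable_on_def
    by (metis DERIV_deriv_iff_real_differentiable UNIV_I)
  then have "((\<lambda>y. u * y - f y) has_real_derivative u - deriv f z) (at z)"
    by (auto intro!: derivative_eq_intros)
  from DERIV_local_max[OF this, of 1] z have "u = deriv f z" by simp
  then show ?thesis using smooth_with_upper[OF sm] by simp
qed

text \<open>The quadratic upper bound on \<open>f\<close> turns into a lower bound on the supremum
  at \<open>u + h\<close>. The test point \<open>z + \<gamma> * h\<close> is the best one: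
  \<open>t = \<gamma> * h\<close> maximises
  \<open>h * t - t\<^sup>2 / (2 * \<gamma>)\<close>.\<close>

lemma convex_conjugate_smooth_lower:
  fixes f :: "real \<Rightarrow> real"
  assumes sc: "strongly_convex m f" "m > 0"
    and sm: "smooth_with (1 / \<gamma>) f" and \<gamma>: "\<gamma> > 0"
    and z: "\<And>y. u * y - f y \<le> u * z - f z"
  shows "convex_conjugate f u + h * z + \<gamma> / 2 * h\<^sup>2 \<le> convex_conjugate f (u + h)"
proof -
  have "f (z + \<gamma> * h) \<le> f z + u * (\<gamma> * h) + (1 / \<gamma>) / 2 * (\<gamma> * h)\<^sup>2"
    using smooth_with_upper_argmax[OF sm z, of "z + \<gamma> * h"] by simp
  moreover have "(1 / \<gamma>) / 2 * (\<gamma> * h)\<^sup>2 = \<gamma> / 2 * h\<^sup>2"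
    using \<gamma> by (simp add: power2_eq_square)
  moreover have "(u + h) * (z + \<gamma> * h) - f (z + \<gamma> * h) \<le> convex_conjugate f (u + h)"
    using convex_conjugate_ge[OF sc, of "u + h" "z + \<gamma> * h"] by simp
  moreover have "convex_conjugate f u = u * z - f z"
    using convex_conjugate_eqI[of u f z] z by simp
  ultimately show ?thesis by (simp add: algebra_simps power2_eq_square)
qed

text \<open>The bound is used at the convex combination \<open>p\<close> in the directions of both
  endpoints. In the weighted average the linear terms cancel, and the quadratic weights add up to
  \<open>t * (1 - t)\<close>.\<close>

lemma strongly_convexI_subgradient:
  assumes "\<And>x. \<exists>c. \<forall>h. f x + h \<bullet> c + m / 2 * (norm h)\<^sup>2 \<le> f (x + h)"
  shows "strongly_convex m f"
  unfolding strongly_convex_def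
proof (intro allI ballI)
  fix x y :: 'a and t :: real
  assume t: "t \<in> {0..1}"
  define p where "p = t *\<^sub>R x + (1 - t) *\<^sub>R y"
  obtain c where c: "\<And>h. f p + h \<bullet> c + m / 2 * (norm h)\<^sup>2 \<le> f (p + h)"
    using assms by blast
  have xp: "x = p + (1 - t) *\<^sub>R (x - y)" and yp: "y = p + (- t) *\<^sub>R (x - y)"
    by (auto simp: p_def algebra_simps)
  have "t * (f p + ((1 - t) *\<^sub>R (x - y)) \<bullet> c + m / 2 * (norm ((1 - t) *\<^sub>R (x - y)))\<^sup>2) \<le> t * f x"
    using t c[of "(1 - t) *\<^sub>R (x - y)"] xp by (intro mult_left_mono) auto
  moreover have "(1 - t) * (f p + ((- t) *\<^sub>R (x - y)) \<bullet> c + m / 2 * (norm ((- t) *\<^sub>R (x - y)))\<^sup>2)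
      \<le> (1 - t) * f y"
    using t c[of "(- t) *\<^sub>R (x - y)"] yp by (intro mult_left_mono) auto
  moreover have "t * (a + (1 - t) * b + m / 2 * ((1 - t)\<^sup>2 * k)) + (1 - t) * (a + (- t) * b + m / 2 * ((- t)\<^sup>2 * k))
      = a + m / 2 * t * (1 - t) * k" for a b k
    by (simp add: field_simps power2_eq_square)
  ultimately show "f (t *\<^sub>R x + (1 - t) *\<^sub>R y)
        \<le> t * f x + (1 - t) * f y - m / 2 * t * (1 - t) * (norm (x - y))\<^sup>2"
    unfolding p_def[symmetric] norm_scaleR power_mult_distrib power2_abs inner_scaleR_left
    by (smt (verit))
qed

lemma norm_vec_power2: "(norm (h :: real^'n))\<^sup>2 = (\<Sum>i\<in>UNIV. (h $ i)\<^sup>2)"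
  unfolding power2_norm_eq_inner inner_vec_def by (simp add: power2_eq_square)

lemma matrix_vector_mult_inner_columns:
  fixes A :: "real^'n^'d"
  shows "(A *v h) \<bullet> w = (\<Sum>i\<in>UNIV. h $ i * (column i A \<bullet> w))"
  by (simp add: matrix_mult_sum inner_sum_left scalar_mult_eq_scaleR)

theorem theorem3:
  fixes A :: "real^'n^'d" and lam \<gamma> \<eta> :: real
    and g :: "real^'d \<Rightarrow> real" and \<phi> :: "'n \<Rightarrow> real \<Rightarrow> real"
    and xk :: "real^'n" and wk :: "real^'d"
  assumes "lam > 0" and "\<gamma> > 0" and "\<eta> > 0"
    and "strongly_convex 1 g"
    and "\<And>i. convex_on UNIV (\<phi> i)"
    and "\<And>i. smooth_with (1 / \<gamma>) (\<phi> i)"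
    and "\<And>i. strongly_convex (1 / \<eta>) (\<phi> i)"
    and "wk = gradient (convex_conjugate g) ((1 / (lam * real CARD('n))) *\<^sub>R (A *v xk))"
  shows "(\<exists>xs. dual_obj A lam g \<phi> xs = dual_opt A lam g \<phi> \<and>
            (\<forall>x. dual_obj A lam g \<phi> x \<le> dual_obj A lam g \<phi> xs)) \<and>
         primal_obj A lam g \<phi> wk - dual_obj A lam g \<phi> xk
           \<le> (lam * \<eta> * real CARD('n) + (spectral_norm A)\<^sup>2) / (lam * \<gamma> * real CARD('n))
              * (dual_opt A lam g \<phi> - dual_obj A lam g \<phi> xk)"
proof -

  \<comment> \<open>Maximisers and the dual gradient\<close>
  define n where "n = real CARD('n)"
  have n: "n > 0" by (simp add: n_def)
  note lam = \<open>lam > 0\<close> and \<gamma> = \<open>\<gamma> > 0\<close> and \<eta> = \<open>\<eta> > 0\<close>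
  have \<eta>': "1 / \<eta> > 0" using \<eta> by simp
  note g = assms(4) and smooth = assms(6) and sc = assms(7)
  let ?D = "dual_obj A lam g \<phi>"
  define v where "v x = (1 / (lam * n)) *\<^sub>R (A *v x)" for x
  have v_add: "v (x + h) = v x + v h" for x h
    by (simp add: v_def matrix_vector_right_distrib scaleR_add_right)
  have D_eq: "?D x = - (1 / n * (\<Sum>i\<in>UNIV. convex_conjugate (\<phi> i) (- (x $ i))))
      - lam * convex_conjugate g (v x)" for x
    by (simp add: dual_obj_def n_def v_def sum_negf)
  \<comment> \<open>The factor \<open>lam\<close> cancels, so the first-order change of the
    \<open>g\<close> term is an average over coordinates, like that of the \<open>\<phi>\<close>
    terms.\<close>
  have v_inner: "lam * (v h \<bullet> w) = 1 / n * (\<Sum>i\<in>UNIV. h $ i * (column i A \<bullet> w))" for h w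
    using lam by (simp add: v_def matrix_vector_mult_inner_columns)

  have "\<exists>w. \<forall>y. v x \<bullet> y - g y \<le> v x \<bullet> w - g w" for x
    by (rule convex_conjugate_attained[OF g zero_less_one, of "v x"]) blast
  then obtain w where w: "\<And>x y. v x \<bullet> y - g y \<le> v x \<bullet> w x - g (w x)"
    by metis
  have z_ex: "\<exists>z. \<forall>y. u * y - \<phi> i y \<le> u * z - \<phi> i z" for i u
    by (rule convex_conjugate_attained[OF sc[of i] \<eta>', of u]) (unfold inner_real_def, blast)
  define z where "z i u = (SOME z. \<forall>y. u * y - \<phi> i y \<le> u * z - \<phi> i z)" for i u
  have z: "u * y - \<phi> i y \<le> u * z i u - \<phi> i (z i u)" for i u y
    using someI_ex[OF z_ex] unfolding z_def by blast
  \<comment> \<open>Here \<open>z i (- (x $ i))\<close> and \<open>w x\<close> are the gradients of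
    the conjugates of \<open>\<phi> i\<close> and \<open>g\<close>, hence \<open>d x / n\<close> is
    the gradient of the dual objective at \<open>x\<close>.\<close>
  define d :: "real^'n \<Rightarrow> real^'n" where
    "d x = (\<chi> i. z i (- (x $ i)) - column i A \<bullet> w x)" for x
  have inner_d: "h \<bullet> d x = (\<Sum>i\<in>UNIV. h $ i * z i (- (x $ i))) - (\<Sum>i\<in>UNIV. h $ i * (column i A \<bullet> w x))" for h x
    unfolding inner_vec_def[of h "d x"] by (simp add: d_def right_diff_distrib sum_subtractf)

  have average: "1 / n * (\<Sum>i\<in>UNIV. a i - b i + c / 2 * (h $ i)\<^sup>2)
      = 1 / n * (\<Sum>i\<in>UNIV. a i) - 1 / n * (\<Sum>i\<in>UNIV. b i) + c / (2 * n) * (norm h)\<^sup>2"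
    for a b :: "'n \<Rightarrow> real" and c and h :: "real^'n"
    unfolding norm_vec_power2 sum.distrib sum_subtractf sum_distrib_left[symmetric]
    by (simp add: add_divide_distrib diff_divide_distrib)

  \<comment> \<open>Existence of the dual maximum\<close>
  have lower: "- ?D x + h \<bullet> (- (1 / n) *\<^sub>R d x) + (\<gamma> / n) / 2 * (norm h)\<^sup>2 \<le> - ?D (x + h)" for x h
  proof -
    have "(\<Sum>i\<in>UNIV. convex_conjugate (\<phi> i) (- (x $ i)) - h $ i * z i (- (x $ i)) + \<gamma> / 2 * (h $ i)\<^sup>2)
        \<le> (\<Sum>i\<in>UNIV. convex_conjugate (\<phi> i) (- ((x + h) $ i)))"
    proof (rule sum_mono)
      fix i
      show "convex_conjugate (\<phi> i) (- (x $ i)) - h $ i * z i (- (x $ i)) + \<gamma> / 2 * (h $ i)\<^sup>2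
          \<le> convex_conjugate (\<phi> i) (- ((x + h) $ i))"
        using convex_conjugate_smooth_lower[OF sc \<eta>' smooth \<gamma> z, of i "- (x $ i)" "- (h $ i)"] by simp
    qed
    then have "1 / n * (\<Sum>i\<in>UNIV. convex_conjugate (\<phi> i) (- (x $ i)) - h $ i * z i (- (x $ i)) + \<gamma> / 2 * (h $ i)\<^sup>2)
        \<le> 1 / n * (\<Sum>i\<in>UNIV. convex_conjugate (\<phi> i) (- ((x + h) $ i)))"
      using n by (intro mult_left_mono) auto
    \<comment> \<open>For \<open>g\<close> the subgradient inequality suffices; the whole quadratic
      term comes from the conjugates of the \<open>\<phi> i\<close>.\<close>
    moreover have "lam * (convex_conjugate g (v x) + v h \<bullet> w x) \<le> lam * convex_conjugate g (v (x + h))"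
      unfolding v_add using lam by (intro mult_left_mono convex_conjugate_lower[OF g zero_less_one w]) auto
    moreover have "h \<bullet> (- (1 / n) *\<^sub>R d x)
        = 1 / n * (\<Sum>i\<in>UNIV. h $ i * (column i A \<bullet> w x)) - 1 / n * (\<Sum>i\<in>UNIV. h $ i * z i (- (x $ i)))"
      by (simp add: inner_d diff_divide_distrib)
    moreover have "(\<gamma> / n) / 2 * (norm h)\<^sup>2 = \<gamma> / (2 * n) * (norm h)\<^sup>2"
      by simp
    ultimately show ?thesis
      unfolding D_eq distrib_left v_inner average by argo
  qed
  have "strongly_convex (\<gamma> / n) (\<lambda>x. - ?D x)"
    using lower by (intro strongly_convexI_subgradient) blast
  from strongly_convex_attains_min[OF this] \<gamma> n
  obtain xs where xs: "\<And>x. ?D x \<le> ?D xs"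
    by auto
  then have opt: "dual_opt A lam g \<phi> = ?D xs"
    unfolding dual_opt_def by (intro cSup_eq_maximum) auto

  \<comment> \<open>Smoothness of the dual objective and one gradient step\<close>
  define K where "K = lam * \<eta> * n + (spectral_norm A)\<^sup>2"
  have K: "K > 0" using lam \<eta> n by (simp add: K_def add_pos_nonneg)
  \<comment> \<open>The smoothness constant \<open>K / (lam * n\<^sup>2)\<close> is the sum of
    \<open>\<eta> / n\<close>, from the conjugates of the \<open>\<phi> i\<close>, and
    \<open>(spectral_norm A)\<^sup>2 / (lam * n\<^sup>2)\<close>, from that of \<open>g\<close>
    composed with \<open>v\<close>.\<close>
  have ascent: "?D x + 1 / n * (h \<bullet> d x) - K / (2 * lam * n\<^sup>2) * (norm h)\<^sup>2 \<le> ?D (x + h)" for x h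
  proof -
    have "(\<Sum>i\<in>UNIV. convex_conjugate (\<phi> i) (- ((x + h) $ i)))
        \<le> (\<Sum>i\<in>UNIV. convex_conjugate (\<phi> i) (- (x $ i)) - h $ i * z i (- (x $ i)) + \<eta> / 2 * (h $ i)\<^sup>2)"
    proof (rule sum_mono)
      fix i
      show "convex_conjugate (\<phi> i) (- ((x + h) $ i))
          \<le> convex_conjugate (\<phi> i) (- (x $ i)) - h $ i * z i (- (x $ i)) + \<eta> / 2 * (h $ i)\<^sup>2"
        using convex_conjugate_upper[OF sc[of i] \<eta>', of "- (x $ i)" "z i (- (x $ i))" "- (h $ i)"]
          z[of "- (x $ i)" _ i] by (simp add: mult.commute)
    qed
    then have "1 / n * (\<Sum>i\<in>UNIV. convex_conjugate (\<phi> i) (- ((x + h) $ i)))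
        \<le> 1 / n * (\<Sum>i\<in>UNIV. convex_conjugate (\<phi> i) (- (x $ i)) - h $ i * z i (- (x $ i)) + \<eta> / 2 * (h $ i)\<^sup>2)"
      using n by (intro mult_left_mono) auto
    also have "\<dots> = 1 / n * (\<Sum>i\<in>UNIV. convex_conjugate (\<phi> i) (- (x $ i)))
        - 1 / n * (\<Sum>i\<in>UNIV. h $ i * z i (- (x $ i))) + \<eta> / (2 * n) * (norm h)\<^sup>2"
      by (rule average)
    finally have 1: "1 / n * (\<Sum>i\<in>UNIV. convex_conjugate (\<phi> i) (- ((x + h) $ i))) \<le> \<dots>" .
    have "lam * convex_conjugate g (v (x + h))
        \<le> lam * (convex_conjugate g (v x) + v h \<bullet> w x + (norm (v h))\<^sup>2 / (2 * 1))"
      unfolding v_add using lam by (intro mult_left_mono convex_conjugate_upper[OF g zero_less_one w]) auto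
    then have 2: "lam * convex_conjugate g (v (x + h))
        \<le> lam * convex_conjugate g (v x) + 1 / n * (\<Sum>i\<in>UNIV. h $ i * (column i A \<bullet> w x)) + lam * (norm (v h))\<^sup>2 / 2"
      unfolding distrib_left v_inner by simp
    have "norm (A *v h) \<le> spectral_norm A * norm h"
      unfolding spectral_norm_def by (intro onorm matrix_vector_mul_bounded_linear)
    then have "(norm (A *v h))\<^sup>2 \<le> (spectral_norm A)\<^sup>2 * (norm h)\<^sup>2"
      by (metis norm_ge_zero power_mono power_mult_distrib)
    then have "(norm (A *v h))\<^sup>2 / (2 * lam * n\<^sup>2) \<le> (spectral_norm A)\<^sup>2 * (norm h)\<^sup>2 / (2 * lam * n\<^sup>2)"
      using lam n by (intro divide_right_mono) auto
    moreover have "lam * (norm (v h))\<^sup>2 / 2 = (norm (A *v h))\<^sup>2 / (2 * lam * n\<^sup>2)"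
      using lam n by (simp add: v_def power_mult_distrib power_divide power2_eq_square)
    moreover have "K / (2 * lam * n\<^sup>2) * (norm h)\<^sup>2
        = \<eta> / (2 * n) * (norm h)\<^sup>2 + (spectral_norm A)\<^sup>2 * (norm h)\<^sup>2 / (2 * lam * n\<^sup>2)"
      using lam n by (simp add: K_def field_simps power2_eq_square)
    moreover have "1 / n * (h \<bullet> d x)
        = 1 / n * (\<Sum>i\<in>UNIV. h $ i * z i (- (x $ i))) - 1 / n * (\<Sum>i\<in>UNIV. h $ i * (column i A \<bullet> w x))"
      by (simp add: inner_d diff_divide_distrib)
    ultimately show ?thesis
      using 1 2 unfolding D_eq by linarith
  qed
  have gain: "lam / (2 * K) * (norm (d xk))\<^sup>2 \<le> ?D xs - ?D xk"
  proof -
    \<comment> \<open>This step length maximises the lower bound in \<open>ascent\<close> along the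
      direction \<open>d xk\<close>.\<close>
    define s where "s = lam * n / K"
    have "?D xk + 1 / n * ((s *\<^sub>R d xk) \<bullet> d xk) - K / (2 * lam * n\<^sup>2) * (norm (s *\<^sub>R d xk))\<^sup>2 \<le> ?D xs"
      using ascent xs order_trans by blast
    moreover have "1 / n * ((s *\<^sub>R d xk) \<bullet> d xk) = lam / K * (norm (d xk))\<^sup>2"
      using n by (simp add: s_def power2_norm_eq_inner)
    moreover have "K / (2 * lam * n\<^sup>2) * (norm (s *\<^sub>R d xk))\<^sup>2 = lam / (2 * K) * (norm (d xk))\<^sup>2"
      using n K lam by (simp add: s_def power_mult_distrib power_divide power2_eq_square)
    moreover have "lam / K * (norm (d xk))\<^sup>2 = 2 * (lam / (2 * K) * (norm (d xk))\<^sup>2)"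
      by simp
    ultimately show ?thesis by linarith
  qed

  \<comment> \<open>The duality gap and its comparison with the dual suboptimality\<close>
  have wk: "wk = w xk"
    using assms(8) gradient_eqI[OF GDERIV_convex_conjugate[OF g zero_less_one w]]
    by (simp add: v_def n_def)
  have gap: "primal_obj A lam g \<phi> wk - ?D xk \<le> 1 / (2 * \<gamma> * n) * (norm (d xk))\<^sup>2"
  proof -
    let ?a = "\<lambda>i. column i A \<bullet> w xk"
    \<comment> \<open>Each summand is a Fenchel-Young gap. It would vanish if \<open>?a i\<close>
      were the maximiser \<open>z i (- (xk $ i))\<close>, and smoothness of \<open>\<phi> i\<close>
      bounds it by the squared distance between the two.\<close>
    have "(\<Sum>i\<in>UNIV. \<phi> i (?a i) + convex_conjugate (\<phi> i) (- (xk $ i)) + xk $ i * ?a i)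
        \<le> (\<Sum>i\<in>UNIV. 1 / (2 * \<gamma>) * (d xk $ i)\<^sup>2)"
    proof (rule sum_mono)
      fix i
      let ?z = "z i (- (xk $ i))"
      have "convex_conjugate (\<phi> i) (- (xk $ i)) = - (xk $ i) * ?z - \<phi> i ?z"
        using convex_conjugate_eqI[of "- (xk $ i)" "\<phi> i" ?z] z[of "- (xk $ i)" _ i] by simp
      moreover have "\<phi> i (?a i) \<le> \<phi> i ?z + - (xk $ i) * (?a i - ?z) + (1 / \<gamma>) / 2 * (?a i - ?z)\<^sup>2"
        by (rule smooth_with_upper_argmax[OF smooth z])
      moreover have "(?a i - ?z)\<^sup>2 = (d xk $ i)\<^sup>2"
        by (simp add: d_def power2_commute)
      ultimately show "\<phi> i (?a i) + convex_conjugate (\<phi> i) (- (xk $ i)) + xk $ i * ?a i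
          \<le> 1 / (2 * \<gamma>) * (d xk $ i)\<^sup>2"
        by (simp add: algebra_simps)
    qed
    then have "1 / n * (\<Sum>i\<in>UNIV. \<phi> i (?a i) + convex_conjugate (\<phi> i) (- (xk $ i)) + xk $ i * ?a i)
        \<le> 1 / n * (\<Sum>i\<in>UNIV. 1 / (2 * \<gamma>) * (d xk $ i)\<^sup>2)"
      using n by (intro mult_left_mono) auto
    also have "\<dots> = 1 / (2 * \<gamma> * n) * (norm (d xk))\<^sup>2"
      by (simp add: norm_vec_power2 sum_distrib_left[symmetric] sum_divide_distrib[symmetric] mult.commute)
    also have "1 / n * (\<Sum>i\<in>UNIV. \<phi> i (?a i) + convex_conjugate (\<phi> i) (- (xk $ i)) + xk $ i * ?a i)
        = 1 / n * (\<Sum>i\<in>UNIV. \<phi> i (?a i)) + 1 / n * (\<Sum>i\<in>UNIV. convex_conjugate (\<phi> i) (- (xk $ i)))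
          + lam * (v xk \<bullet> w xk)"
      unfolding v_inner sum.distrib distrib_left ..
    \<comment> \<open>Fenchel equality for \<open>g\<close>, valid because \<open>w xk\<close>
      attains the supremum at \<open>v xk\<close>. It turns the coordinate average into exactly the
      primal value minus the dual value.\<close>
    also have "lam * (v xk \<bullet> w xk) = lam * g (w xk) + lam * convex_conjugate g (v xk)"
      using convex_conjugate_eqI[OF w, of xk] by (simp add: right_diff_distrib)
    finally show ?thesis
      unfolding primal_obj_def D_eq wk n_def[symmetric] by linarith
  qed
  \<comment> \<open>The constant of the theorem is the ratio of the factor
    \<open>1 / (2 * \<gamma> * n)\<close> in \<open>gap\<close> to the factor
    \<open>lam / (2 * K)\<close> in \<open>gain\<close>.\<close>
  also have "\<dots> = K / (lam * \<gamma> * n) * (lam / (2 * K) * (norm (d xk))\<^sup>2)"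
    using K lam by simp
  also have "\<dots> \<le> K / (lam * \<gamma> * n) * (?D xs - ?D xk)"
    using gain K lam \<gamma> n by (intro mult_left_mono) auto
  finally show ?thesis
    using xs opt unfolding K_def n_def by auto
qed

end
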